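(* Let $G$ be a (Hausdorff) compact group, and suppose that the set $$\mathcal{N}_2(G)=\{(x_1,x_2,x_3)\in G\times G\times G \;:\; [x_1,x_2,x_3]=1\}$$ has positive Haar measure in $G\times G\times G$. Then $G$ has an open subgroup that is nilpotent of class at most $2$.
   Context: Commutators: $[x,y]=x^{-1}y^{-1}xy$ and $[x,y,z]=[[x,y],z]$. Haar measure on the compact group $G\times G\times G$ means its unique normalized Haar measure. A "$2$-step nilpotent" group is a group that is nilpotent of class at most $2$, i.e. $[a,b,c]=1$ for all $a,b,c$ in it. *)

theory Defs
  imports "HOL-Analysis.Analysis" "HOL-Algebra.Group"
begin

definition gcomm :: "('a, 'b) monoid_scheme \<Rightarrow> 'a \<Rightarrow> 'a \<Rightarrow> 'a" where
  "gcomm G x y = inv\<^bsub>G\<^esub> x \<otimes>\<^bsub>G\<^esub> inv\<^bsub>G\<^esub> y \<otimes>\<^bsub>G\<^esub> x \<otimes>\<^bsub>G\<^esub> y"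

definition gcomm3 :: "('a, 'b) monoid_scheme \<Rightarrow> 'a \<Rightarrow> 'a \<Rightarrow> 'a \<Rightarrow> 'a" where
  "gcomm3 G x y z = gcomm G (gcomm G x y) z"

definition topological_group :: "('a, 'b) monoid_scheme \<Rightarrow> 'a topology \<Rightarrow> bool" where
  "topological_group G T \<longleftrightarrow> group G \<and> topspace T = carrier G \<and>
     continuous_map (prod_topology T T) T (\<lambda>(x, y). x \<otimes>\<^bsub>G\<^esub> y) \<and>
     continuous_map T T (\<lambda>x. inv\<^bsub>G\<^esub> x)"

definition compact_group :: "('a, 'b) monoid_scheme \<Rightarrow> 'a topology \<Rightarrow> bool" where
  "compact_group G T \<longleftrightarrow> topological_group G T \<and> compact_space T \<and> Hausdorff_space T"

definition top3 :: "'a topology \<Rightarrow> ('a \<times> 'a \<times> 'a) topology" where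
  "top3 T = prod_topology T (prod_topology T T)"

definition mult3 :: "('a, 'b) monoid_scheme \<Rightarrow> 'a \<times> 'a \<times> 'a \<Rightarrow> 'a \<times> 'a \<times> 'a \<Rightarrow> 'a \<times> 'a \<times> 'a" where
  "mult3 G g x = (fst g \<otimes>\<^bsub>G\<^esub> fst x, fst (snd g) \<otimes>\<^bsub>G\<^esub> fst (snd x),
                  snd (snd g) \<otimes>\<^bsub>G\<^esub> snd (snd x))"

text \<open>M is the (normalized) Haar measure of the compact group G x G x G:
  a left-invariant Radon probability measure on the Borel sets.  By uniqueness of
  Haar measure, these conditions characterize it.\<close>
definition haar3 :: "('a, 'b) monoid_scheme \<Rightarrow> 'a topology \<Rightarrow> ('a \<times> 'a \<times> 'a) measure \<Rightarrow> bool" where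
  "haar3 G T M \<longleftrightarrow>
     space M = carrier G \<times> carrier G \<times> carrier G \<and>
     sets M = sigma_sets (space M) {U. openin (top3 T) U} \<and>
     emeasure M (space M) = 1 \<and>
     (\<forall>g \<in> space M. \<forall>A \<in> sets M. emeasure M (mult3 G g ` A) = emeasure M A) \<and>
     (\<forall>A \<in> sets M. emeasure M A = (INF U \<in> {U. openin (top3 T) U \<and> A \<subseteq> U}. emeasure M U)) \<and>
     (\<forall>U. openin (top3 T) U \<longrightarrow>
        emeasure M U = (SUP K \<in> {K. compactin (top3 T) K \<and> K \<subseteq> U}. emeasure M K))"

definition N2 :: "('a, 'b) monoid_scheme \<Rightarrow> ('a \<times> 'a \<times> 'a) set" where
  "N2 G = {(x1, x2, x3). x1 \<in> carrier G \<and> x2 \<in> carrier G \<and> x3 \<in> carrier G \<and>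
            gcomm3 G x1 x2 x3 = \<one>\<^bsub>G\<^esub>}"

definition nilpotent2_on :: "('a, 'b) monoid_scheme \<Rightarrow> 'a set \<Rightarrow> bool" where
  "nilpotent2_on G H \<longleftrightarrow> (\<forall>a \<in> H. \<forall>b \<in> H. \<forall>c \<in> H. gcomm3 G a b c = \<one>\<^bsub>G\<^esub>)"

end

theory Submission
  imports Defs "HOL-Algebra.Generated_Groups"
begin

text \<open>
  Write \<open>C(x, y)\<close> for the centralizer of \<open>[x, y]\<close>, so that \<open>(x, y, z)\<close> lies in the set
  \<open>N\<close> of positive measure iff \<open>z \<in> C(x, y)\<close>. If \<open>C(x, y)\<close> has index at least \<open>n\<close> for all
  \<open>(x, y)\<close> in \<open>P\<close>, then locally \<open>n\<close> translates of \<open>N\<close> in the third coordinate are disjoint over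
  \<open>P\<close>, and \<open>N\<close> fills at most \<open>1/n\<close> of \<open>P \<times> G\<close>; no Fubini theorem is needed. Hence for some
  \<open>n\<close> the closed set of pairs with index less than \<open>n\<close> is not null. For the least such \<open>n\<close>,
  almost all of its pairs have index exactly \<open>n - 1\<close>; there \<open>C(x, y)\<close> is open and locally
  constant, as \<open>C(q) \<subseteq> C(p)\<close> for \<open>q\<close> near \<open>p\<close>. So a fixed open subgroup \<open>C\<close> is contained in
  \<open>C(x, y)\<close> for a closed set \<open>F\<close> of pairs of positive measure.

  By a Steinhaus argument, for \<open>a, b\<close> near \<open>1\<close> there are \<open>x, y\<close> such that \<open>(x, y)\<close>,
  \<open>(a x, y)\<close>, \<open>(x, b y)\<close> and \<open>(a x, b y)\<close> all lie in \<open>F\<close>, whence a conjugate of \<open>[a, b]\<close>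
  centralizes \<open>C\<close>. As every conjugate of an element \<open>c\<close> close to \<open>1\<close> lies in \<open>C\<close>, it follows
  that \<open>[a, b, c] = 1\<close> for \<open>a, b, c\<close> in a neighbourhood of \<open>1\<close>. This neighbourhood generates
  the required subgroup.
\<close>

section \<open>Commutator identities\<close>

context group
begin

lemma mult_inv_cancel:
  assumes "x \<in> carrier G" "y \<in> carrier G"
  shows "x \<otimes> (inv x \<otimes> y) = y" "inv x \<otimes> (x \<otimes> y) = y"
  using assms by (simp_all flip: m_assoc)

lemma gcomm_closed [simp, intro]:
  "x \<in> carrier G \<Longrightarrow> y \<in> carrier G \<Longrightarrow> gcomm G x y \<in> carrier G"
  by (simp add: gcomm_def)

lemma gcomm_eq_one_iff:
  assumes "x \<in> carrier G" "y \<in> carrier G"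
  shows "gcomm G x y = \<one> \<longleftrightarrow> x \<otimes> y = y \<otimes> x"
proof -
  have *: "gcomm G x y = inv (y \<otimes> x) \<otimes> (x \<otimes> y)"
    using assms by (simp add: gcomm_def inv_mult_group m_assoc)
  show ?thesis
  proof
    assume "gcomm G x y = \<one>"
    then have "(y \<otimes> x) \<otimes> (inv (y \<otimes> x) \<otimes> (x \<otimes> y)) = y \<otimes> x"
      using assms by (simp add: *)
    then show "x \<otimes> y = y \<otimes> x"
      using assms by (simp only: mult_inv_cancel m_closed)
  next
    assume "x \<otimes> y = y \<otimes> x"
    then show "gcomm G x y = \<one>"
      using assms by (simp add: *)
  qed
qed

section \<open>Centralizers, and nilpotency read off from generators\<close>

definition centralizer :: "'a set \<Rightarrow> 'a set" where
  "centralizer A = {z \<in> carrier G. \<forall>a\<in>A. a \<otimes> z = z \<otimes> a}"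

lemma centralizer_subgroup:
  assumes "A \<subseteq> carrier G"
  shows "subgroup (centralizer A) G"
proof (rule subgroupI)
  show "centralizer A \<subseteq> carrier G" "centralizer A \<noteq> {}"
    using assms by (auto simp: centralizer_def intro!: exI[of _ \<one>])
next
  fix z assume z: "z \<in> centralizer A"
  have "a \<otimes> inv z = inv z \<otimes> a" if "a \<in> A" for a
  proof -
    have a: "a \<in> carrier G" and zc: "z \<in> carrier G" and e: "a \<otimes> z = z \<otimes> a"
      using that assms z by (auto simp: centralizer_def)
    have "inv z \<otimes> (a \<otimes> z) \<otimes> inv z = a \<otimes> inv z"
      unfolding e using a zc by (simp add: mult_inv_cancel)
    then show ?thesis
      using a zc by (simp add: m_assoc)
  qed
  then show "inv z \<in> centralizer A"
    using z by (auto simp: centralizer_def)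
next
  fix z w assume zw: "z \<in> centralizer A" "w \<in> centralizer A"
  have "a \<otimes> (z \<otimes> w) = z \<otimes> w \<otimes> a" if "a \<in> A" for a
  proof -
    have c: "a \<in> carrier G" "z \<in> carrier G" "w \<in> carrier G"
      and e: "a \<otimes> z = z \<otimes> a" "a \<otimes> w = w \<otimes> a"
      using that assms zw by (auto simp: centralizer_def)
    have "a \<otimes> (z \<otimes> w) = (a \<otimes> z) \<otimes> w"
      using c by (simp only: m_assoc)
    also have "\<dots> = z \<otimes> (a \<otimes> w)"
      using c by (simp only: e(1) m_assoc)
    also have "\<dots> = z \<otimes> w \<otimes> a"
      using c by (simp only: e(2) m_assoc)
    finally show ?thesis .
  qed
  then show "z \<otimes> w \<in> centralizer A"
    using zw by (auto simp: centralizer_def)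
qed

lemma centralizer_sym:
  assumes "B \<subseteq> carrier G" "A \<subseteq> centralizer B"
  shows "B \<subseteq> centralizer A"
  using assms unfolding centralizer_def by fastforce

text \<open>Cancelling gives \<open>p = inv x \<otimes> inv a \<otimes> inv y \<otimes> a \<otimes>
  y \<otimes> x\<close>, and \<open>q\<close> is the same word with \<open>b \<otimes> y\<close> for
  \<open>y\<close>. In \<open>inv p \<otimes> q\<close> everything cancels except the conjugate of
  \<open>gcomm G a b\<close>.\<close>

lemma gcomm_mem_conjugate:
  assumes D: "subgroup D G"
    and [simp]: "a \<in> carrier G" "b \<in> carrier G" "x \<in> carrier G" "y \<in> carrier G"
    and mem: "gcomm G x y \<in> D" "gcomm G (a \<otimes> x) y \<in> D"
      "gcomm G x (b \<otimes> y) \<in> D" "gcomm G (a \<otimes> x) (b \<otimes> y) \<in> D"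
  shows "inv (y \<otimes> x) \<otimes> gcomm G a b \<otimes> (y \<otimes> x) \<in> D"
proof -
  define p where "p = gcomm G (a \<otimes> x) y \<otimes> inv (gcomm G x y)"
  define q where "q = gcomm G (a \<otimes> x) (b \<otimes> y) \<otimes> inv (gcomm G x (b \<otimes> y))"
  have "inv p \<otimes> q \<in> D"
    using mem D unfolding p_def q_def
    by (intro subgroup.m_closed subgroup.m_inv_closed)
  also have "inv p \<otimes> q = inv (y \<otimes> x) \<otimes> gcomm G a b \<otimes> (y \<otimes> x)"
    by (simp add: p_def q_def gcomm_def inv_mult_group m_assoc mult_inv_cancel)
  finally show ?thesis .
qed

text \<open>Commutators of generators centralize \<open>W\<close>, hence all of \<open>H\<close>. So
  the generators commute modulo \<open>Z\<close>, therefore so do all elements of \<open>H\<close>,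
  and every commutator in \<open>H\<close> lies in \<open>Z\<close>.\<close>

lemma generate_nilpotent2:
  assumes W: "W \<subseteq> carrier G"
    and comm: "\<And>a b c. a \<in> W \<Longrightarrow> b \<in> W \<Longrightarrow> c \<in> W \<Longrightarrow> gcomm3 G a b c = \<one>"
  shows "nilpotent2_on G (generate G W)"
proof -
  define H where "H = generate G W"
  define Z where "Z = centralizer H"
  have H: "subgroup H G"
    unfolding H_def by (rule generate_is_subgroup[OF W])
  have Hc: "H \<subseteq> carrier G"
    by (rule subgroup.subset[OF H])
  have Z: "subgroup Z G"
    unfolding Z_def by (rule centralizer_subgroup[OF Hc])
  have Zc: "z \<in> carrier G" if "z \<in> Z" for z
    using that by (simp add: Z_def centralizer_def)
  have Zcomm: "h \<otimes> z = z \<otimes> h" if "h \<in> H" "z \<in> Z" for h z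
    using that by (simp add: Z_def centralizer_def)
  have base: "gcomm G a b \<in> Z" if "a \<in> W" "b \<in> W" for a b
  proof -
    have d: "gcomm G a b \<in> carrier G"
      using that W by auto
    have "W \<subseteq> centralizer {gcomm G a b}"
      using comm[OF that] W d gcomm_eq_one_iff
      by (fastforce simp: gcomm3_def centralizer_def)
    then have "H \<subseteq> centralizer {gcomm G a b}"
      unfolding H_def using d by (intro generate_subgroup_incl centralizer_subgroup) auto
    then show ?thesis
      using d unfolding Z_def centralizer_def by auto
  qed
  \<comment> \<open>Commuting modulo \<open>Z\<close>, phrased with a correcting factor instead of a
    quotient group. The factor is forced to be \<open>gcomm G x y\<close>.\<close>
  define R where "R x y \<longleftrightarrow> (\<exists>z\<in>Z. x \<otimes> y = y \<otimes> x \<otimes> z)" for x y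
  have R_gcomm: "R x y \<longleftrightarrow> gcomm G x y \<in> Z" if "x \<in> H" "y \<in> H" for x y
  proof -
    have [simp]: "x \<in> carrier G" "y \<in> carrier G"
      using that Hc by auto
    have "x \<otimes> y = y \<otimes> x \<otimes> z \<longleftrightarrow> z = gcomm G x y" if "z \<in> carrier G" for z
      using that by (auto simp: gcomm_def m_assoc mult_inv_cancel)
    then show ?thesis
      unfolding R_def using Zc by auto
  qed
  have R_sym: "R y x" if "R x y" "x \<in> H" "y \<in> H" for x y
  proof -
    have [simp]: "x \<in> carrier G" "y \<in> carrier G"
      using that Hc by auto
    obtain z where z: "z \<in> Z" "x \<otimes> y = y \<otimes> x \<otimes> z"
      using \<open>R x y\<close> unfolding R_def by blast
    have "y \<otimes> x = x \<otimes> y \<otimes> inv z"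
      unfolding z(2) using Zc[OF z(1)] by (simp add: m_assoc)
    then show ?thesis
      using z Z by (auto simp: R_def intro: subgroup.m_inv_closed)
  qed
  have R_gen: "R x h" if x: "x \<in> H" and xW: "\<And>w. w \<in> W \<Longrightarrow> R x w" and h: "h \<in> H" for x h
  proof -
    have [simp]: "x \<in> carrier G"
      using x Hc by auto
    from h[unfolded H_def] show ?thesis
    proof induction
      case one
      then show ?case
        using subgroup.one_closed[OF Z] by (auto simp: R_def intro!: bexI[of _ \<one>])
    next
      case (incl h)
      then show ?case by (rule xW)
    next
      case (inv h)
      have hH: "h \<in> H" "inv h \<in> H"
        using inv by (auto simp: H_def intro: generate.intros)
      then have [simp]: "h \<in> carrier G"
        using Hc by auto
      obtain z where z: "z \<in> Z" "x \<otimes> h = h \<otimes> x \<otimes> z"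
        using xW[OF inv] unfolding R_def by blast
      have [simp]: "z \<in> carrier G" using z Zc by auto
      have "inv h \<otimes> (x \<otimes> h) \<otimes> inv h = x \<otimes> z \<otimes> inv h"
        unfolding z(2) by (simp add: m_assoc mult_inv_cancel)
      then have "inv h \<otimes> x = x \<otimes> z \<otimes> inv h"
        by (simp add: m_assoc)
      also have "\<dots> = x \<otimes> inv h \<otimes> z"
        using Zcomm[OF hH(2) z(1)] by (simp add: m_assoc)
      finally have e: "inv h \<otimes> x = x \<otimes> inv h \<otimes> z" .
      have "x \<otimes> inv h = inv h \<otimes> x \<otimes> inv z"
        unfolding e by (simp add: m_assoc)
      then show ?case
        using z Z by (auto simp: R_def intro: subgroup.m_inv_closed)
    next
      case (eng h k)
      have hk: "h \<in> H" "k \<in> H"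
        using eng by (auto simp: H_def)
      then have [simp]: "h \<in> carrier G" "k \<in> carrier G"
        using Hc by auto
      obtain z z' where z: "z \<in> Z" "x \<otimes> h = h \<otimes> x \<otimes> z" "z' \<in> Z" "x \<otimes> k = k \<otimes> x \<otimes> z'"
        using eng unfolding R_def by blast
      have [simp]: "z \<in> carrier G" "z' \<in> carrier G" using z Zc by auto
      have "x \<otimes> (h \<otimes> k) = h \<otimes> x \<otimes> z \<otimes> k"
        unfolding z(2)[symmetric] by (simp add: m_assoc)
      also have "\<dots> = h \<otimes> (x \<otimes> k) \<otimes> z"
        using Zcomm[OF hk(2) z(1)] by (simp add: m_assoc)
      also have "\<dots> = (h \<otimes> k) \<otimes> x \<otimes> (z' \<otimes> z)"
        unfolding z(4) by (simp add: m_assoc)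
      finally show ?case
        using z Z by (auto simp: R_def intro: subgroup.m_closed)
    qed
  qed
  have WH: "w \<in> H" if "w \<in> W" for w
    using that by (simp add: H_def generate.incl)
  have "R w h" if "w \<in> W" "h \<in> H" for w h
    using that by (rule_tac R_gen) (auto simp: R_gcomm WH base)
  \<comment> \<open>The first use of \<open>R_gen\<close> has a generator on the left; symmetry
    moves it to the right, which is the hypothesis for a second use.\<close>
  then have "R h k" if "h \<in> H" "k \<in> H" for h k
    using that by (rule_tac R_gen) (auto intro: R_sym WH)
  then have "gcomm G h k \<in> Z" if "h \<in> H" "k \<in> H" for h k
    using that R_gcomm by blast
  then have "gcomm3 G h k l = \<one>" if "h \<in> H" "k \<in> H" "l \<in> H" for h k l
    using that Hc Zcomm[of l "gcomm G h k"] by (subst gcomm3_def, subst gcomm_eq_one_iff) auto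
  then show ?thesis
    by (simp add: nilpotent2_on_def H_def)
qed

end

section \<open>Centralizers of commutators in a compact group\<close>

lemma continuous_map_fst' [continuous_intros]:
  "continuous_map X (prod_topology Y Z) f \<Longrightarrow> continuous_map X Y (\<lambda>x. fst (f x))"
  and continuous_map_snd' [continuous_intros]:
  "continuous_map X (prod_topology Y Z) f \<Longrightarrow> continuous_map X Z (\<lambda>x. snd (f x))"
  by (auto simp: continuous_map_pairwise o_def)

lemmas continuous_map_ident = continuous_map_id[unfolded id_def]

locale compact_hausdorff_group = group G
  for G :: "('a, 'b) monoid_scheme" (structure) +
  fixes T :: "'a topology"
  assumes compact_group: "compact_group G T"
begin

section \<open>Continuity and neighbourhoods of the identity\<close>

lemma topspace_T [simp]: "topspace T = carrier G"
  and compact_T: "compact_space T"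
  and Hausdorff_T: "Hausdorff_space T"
  using compact_group by (auto simp: compact_group_def topological_group_def)

lemma continuous_map_m [continuous_intros]:
  assumes "continuous_map X T f" "continuous_map X T g"
  shows "continuous_map X T (\<lambda>x. f x \<otimes> g x)"
proof -
  have "continuous_map (prod_topology T T) T (\<lambda>(x, y). x \<otimes> y)"
    using compact_group by (auto simp: compact_group_def topological_group_def)
  from continuous_map_compose[OF continuous_map_pairedI[OF assms] this]
  show ?thesis by (simp add: o_def)
qed

lemma continuous_map_m_inv [continuous_intros]:
  assumes "continuous_map X T f"
  shows "continuous_map X T (\<lambda>x. inv (f x))"
proof -
  have "continuous_map T T (\<lambda>x. inv x)"
    using compact_group by (auto simp: compact_group_def topological_group_def)
  from continuous_map_compose[OF assms this] show ?thesis by (simp add: o_def)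
qed

lemma continuous_map_gcomm [continuous_intros]:
  assumes "continuous_map X T f" "continuous_map X T g"
  shows "continuous_map X T (\<lambda>x. gcomm G (f x) (g x))"
  unfolding gcomm_def by (intro continuous_intros assms)

lemma continuous_map_const_carrier [continuous_intros]:
  "c \<in> carrier G \<Longrightarrow> continuous_map X T (\<lambda>_. c)"
  by simp

lemma closedin_eq_one:
  assumes "continuous_map X T f"
  shows "closedin X {x \<in> topspace X. f x = \<one>}"
  using closedin_continuous_map_preimage[OF assms closedin_Hausdorff_singleton[OF Hausdorff_T, of \<one>]]
  by simp

text \<open>Together with \<open>h\<close> the subgroup contains the whole translate of
  \<open>W\<close> by \<open>h\<close>, a neighbourhood of \<open>h\<close>.\<close>

lemma openin_generate:
  assumes W: "openin T W" "\<one> \<in> W"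
  shows "openin T (generate G W)"
proof -
  have WG: "W \<subseteq> carrier G"
    using openin_subset[OF W(1)] by simp
  have "\<exists>U. openin T U \<and> h \<in> U \<and> U \<subseteq> generate G W" if h: "h \<in> generate G W" for h
  proof (intro exI conjI)
    have hG: "h \<in> carrier G"
      using h generate_incl[OF WG] by blast
    let ?U = "{x \<in> topspace T. inv h \<otimes> x \<in> W}"
    show "openin T ?U"
      using hG by (intro openin_continuous_map_preimage[OF _ W(1)] continuous_intros) auto
    show "h \<in> ?U"
      using hG W by simp
    show "?U \<subseteq> generate G W"
    proof
      fix x assume x: "x \<in> ?U"
      then have "h \<otimes> (inv h \<otimes> x) \<in> generate G W"
        by (intro generate.eng[OF h] generate.incl) simp
      then show "x \<in> generate G W"
        using x hG by (simp add: mult_inv_cancel)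
    qed
  qed
  then show ?thesis
    by (subst openin_subopen) blast
qed

text \<open>Conjugation fixes \<open>\<one>\<close>, so the open set of good pairs contains
  \<open>carrier G \<times> {\<one>}\<close>. Compactness of the group then yields one
  \<open>V\<close> for all \<open>g\<close> at once.\<close>

lemma small_conjugates:
  assumes C: "openin T C" "\<one> \<in> C"
  obtains V where "openin T V" "\<one> \<in> V"
    "\<And>g v. g \<in> carrier G \<Longrightarrow> v \<in> V \<Longrightarrow> inv g \<otimes> v \<otimes> g \<in> C"
proof -
  let ?W = "{p \<in> topspace (prod_topology T T). inv (fst p) \<otimes> snd p \<otimes> fst p \<in> C}"
  have "openin (prod_topology T T) ?W"
    by (intro openin_continuous_map_preimage[OF _ C(1)] continuous_intros)
  moreover have "carrier G \<times> {\<one>} \<subseteq> ?W"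
    using C by auto
  moreover have "compactin T (carrier G)"
    using compact_T by (simp add: compact_space_def)
  ultimately obtain U V where "openin T V" "carrier G \<subseteq> U" "\<one> \<in> V" "U \<times> V \<subseteq> ?W"
    using tube_lemma_left[of T T ?W "carrier G" \<one>] by auto
  then have "(g, v) \<in> ?W" if "g \<in> carrier G" "v \<in> V" for g v
    using that by blast
  then show ?thesis
    using \<open>openin T V\<close> \<open>\<one> \<in> V\<close> by (intro that[of V]) auto
qed

section \<open>Centralizers of commutators: closed conditions, index, local behaviour\<close>

abbreviation T2 :: "('a \<times> 'a) topology" where
  "T2 \<equiv> prod_topology T T"

lemma compact_T2: "compact_space T2"
  and Hausdorff_T2: "Hausdorff_space T2"
  using compact_T Hausdorff_T by (auto simp: compact_space_prod_topology Hausdorff_space_prod_topology)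

lemma topspace_top3 [simp]: "topspace (top3 T) = carrier G \<times> carrier G \<times> carrier G"
  by (simp add: top3_def)

lemma compact_top3: "compact_space (top3 T)"
  and Hausdorff_top3: "Hausdorff_space (top3 T)"
  using compact_T Hausdorff_T
  by (auto simp: top3_def compact_space_prod_topology Hausdorff_space_prod_topology)

text \<open>The slice of \<open>N2 G\<close> over \<open>q\<close> in the third coordinate, as
  \<open>N2_iff\<close> records.\<close>

definition cen :: "'a \<times> 'a \<Rightarrow> 'a set" where
  "cen q = centralizer {gcomm G (fst q) (snd q)}"

lemma cen_subgroup: "q \<in> carrier G \<times> carrier G \<Longrightarrow> subgroup (cen q) G"
  unfolding cen_def by (intro centralizer_subgroup) auto

lemma cen_iff:
  assumes "q \<in> carrier G \<times> carrier G"
  shows "z \<in> cen q \<longleftrightarrow> z \<in> carrier G \<and> gcomm3 G (fst q) (snd q) z = \<one>"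
  using assms by (auto simp: cen_def centralizer_def gcomm3_def gcomm_eq_one_iff)

lemma N2_iff: "(x, y, z) \<in> N2 G \<longleftrightarrow> x \<in> carrier G \<and> y \<in> carrier G \<and> z \<in> cen (x, y)"
  by (auto simp: N2_def cen_iff)

lemma closedin_N2: "closedin (top3 T) (N2 G)"
proof -
  have "N2 G = {p \<in> topspace (top3 T). gcomm G (gcomm G (fst p) (fst (snd p))) (snd (snd p)) = \<one>}"
    by (auto simp: N2_def gcomm3_def)
  also have "closedin (top3 T) \<dots>"
    unfolding top3_def by (intro closedin_eq_one continuous_intros) (rule continuous_map_ident)+
  finally show ?thesis .
qed

lemma closedin_mem_cen:
  assumes "z \<in> carrier G"
  shows "closedin T2 {q \<in> carrier G \<times> carrier G. z \<in> cen q}"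
proof -
  have "{q \<in> carrier G \<times> carrier G. z \<in> cen q} =
      {q \<in> topspace T2. gcomm G (gcomm G (fst q) (snd q)) z = \<one>}"
    using assms by (auto simp: cen_iff gcomm3_def)
  also have "closedin T2 \<dots>"
    using assms by (intro closedin_eq_one continuous_intros)
  finally show ?thesis .
qed

lemma closedin_subset_cen:
  assumes "C \<subseteq> carrier G" "C \<noteq> {}"
  shows "closedin T2 {q \<in> carrier G \<times> carrier G. C \<subseteq> cen q}"
proof -
  have "{q \<in> carrier G \<times> carrier G. C \<subseteq> cen q} = (\<Inter>z\<in>C. {q \<in> carrier G \<times> carrier G. z \<in> cen q})"
    using assms by auto
  also have "closedin T2 \<dots>"
    using assms by (intro closedin_INT closedin_mem_cen) auto
  finally show ?thesis .
qed

text \<open>The members of \<open>S\<close> lie in distinct left cosets of \<open>cen q\<close>, so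
  a finite separated set of size \<open>n\<close> witnesses index at least \<open>n\<close>.
  Infinite index needs no separate treatment.\<close>

definition separated :: "'a set \<Rightarrow> 'a \<times> 'a \<Rightarrow> bool" where
  "separated S q \<longleftrightarrow> (\<forall>s\<in>S. \<forall>t\<in>S. s \<noteq> t \<longrightarrow> inv s \<otimes> t \<notin> cen q)"

text \<open>Each pair \<open>s \<noteq> t\<close> excludes a closed set of \<open>q\<close>;
  finiteness of \<open>S\<close> keeps the union of these closed.\<close>

lemma openin_separated:
  assumes "finite S" "S \<subseteq> carrier G"
  shows "openin T2 {q \<in> carrier G \<times> carrier G. separated S q}"
proof -
  let ?I = "{st \<in> S \<times> S. fst st \<noteq> snd st}"
  have [simp]: "s \<in> carrier G" if "s \<in> S" for s
    using that assms by auto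
  have "{q \<in> carrier G \<times> carrier G. separated S q} =
      topspace T2 - (\<Union>st\<in>?I. {q \<in> carrier G \<times> carrier G. inv (fst st) \<otimes> snd st \<in> cen q})"
    by (auto simp: separated_def)
  also have "openin T2 \<dots>"
    using assms
    by (intro openin_diff openin_topspace closedin_Union)
      (auto intro!: closedin_mem_cen)
  finally show ?thesis .
qed

text \<open>The pairs \<open>(x, y)\<close> for which the centralizer of \<open>[x, y]\<close> has index less than \<open>n\<close>.\<close>

definition small_index :: "nat \<Rightarrow> ('a \<times> 'a) set" where
  "small_index n = {q \<in> carrier G \<times> carrier G.
     \<not> (\<exists>S. finite S \<and> card S = n \<and> S \<subseteq> carrier G \<and> separated S q)}"

lemma small_index_0 [simp]: "small_index 0 = {}"
  by (auto simp: small_index_def separated_def)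

lemma closedin_small_index: "closedin T2 (small_index n)"
proof -
  let ?I = "{S. finite S \<and> card S = n \<and> S \<subseteq> carrier G}"
  have "small_index n = topspace T2 - (\<Union>S\<in>?I. {q \<in> carrier G \<times> carrier G. separated S q})"
    by (auto simp: small_index_def)
  also have "closedin T2 \<dots>"
    by (intro closedin_diff closedin_topspace openin_Union) (auto intro!: openin_separated)
  finally show ?thesis .
qed

text \<open>If \<open>S\<close> missed the coset of \<open>z\<close>, adjoining \<open>z\<close>
  would give a separated set of size \<open>Suc n\<close>.\<close>

lemma separated_transversal:
  assumes q: "q \<in> small_index (Suc n)"
    and S: "finite S" "card S = n" "S \<subseteq> carrier G" "separated S q"
    and z: "z \<in> carrier G"
  shows "\<exists>s\<in>S. inv s \<otimes> z \<in> cen q"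
proof (rule ccontr)
  assume neg: "\<not> ?thesis"
  have qc: "q \<in> carrier G \<times> carrier G"
    using q by (simp add: small_index_def)
  note C = cen_subgroup[OF qc]
  have "z \<notin> S"
    using neg z subgroup.one_closed[OF C] by auto
  then have "card (insert z S) = Suc n"
    using S by simp
  moreover have "separated (insert z S) q"
  proof -
    have "inv z \<otimes> s \<notin> cen q" if "s \<in> S" for s
    proof
      assume "inv z \<otimes> s \<in> cen q"
      then have "inv (inv z \<otimes> s) \<in> cen q"
        by (rule subgroup.m_inv_closed[OF C])
      moreover have "s \<in> carrier G" using that S by auto
      ultimately show False
        using neg z that by (auto simp: inv_mult_group)
    qed
    then show ?thesis
      using S neg unfolding separated_def by blast
  qed
  ultimately show False
    using q S z unfolding small_index_def by blast
qed

text \<open>The index is exactly \<open>n\<close>, so \<open>cen q\<close> is the complement of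
  finitely many closed cosets, those represented by the elements of \<open>S\<close> outside
  \<open>cen q\<close>.\<close>

lemma openin_cen:
  assumes q: "q \<in> small_index (Suc n)" "q \<notin> small_index n"
  shows "openin T (cen q)"
proof -
  have qc: "q \<in> carrier G \<times> carrier G"
    using q by (simp add: small_index_def)
  note C = cen_subgroup[OF qc]
  obtain S where S: "finite S" "card S = n" "S \<subseteq> carrier G" "separated S q"
    using q qc by (auto simp: small_index_def)
  have "cen q = {z \<in> topspace T. gcomm G (gcomm G (fst q) (snd q)) z = \<one>}"
    using qc by (auto simp: cen_iff gcomm3_def)
  also have "closedin T \<dots>"
    using qc by (intro closedin_eq_one continuous_intros) auto
  finally have cl: "closedin T (cen q)" .
  have cls: "closedin T {z \<in> topspace T. inv s \<otimes> z \<in> cen q}" if "s \<in> S" for s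
    using that S
    by (intro closedin_continuous_map_preimage[OF _ cl] continuous_intros continuous_map_ident) auto
  have "cen q = topspace T - (\<Union>s\<in>S - cen q. {z \<in> topspace T. inv s \<otimes> z \<in> cen q})"
  proof (intro equalityI subsetI)
    fix z assume z: "z \<in> cen q"
    have zc: "z \<in> carrier G"
      using z subgroup.subset[OF C] by auto
    have "s \<in> cen q" if "s \<in> S" "inv s \<otimes> z \<in> cen q" for s
    proof -
      have sc: "s \<in> carrier G" using that S by auto
      have "z \<otimes> inv (inv s \<otimes> z) \<in> cen q"
        by (intro subgroup.m_closed[OF C z] subgroup.m_inv_closed[OF C] that)
      then show ?thesis
        using sc zc by (simp add: inv_mult_group mult_inv_cancel)
    qed
    then show "z \<in> topspace T - (\<Union>s\<in>S - cen q. {z \<in> topspace T. inv s \<otimes> z \<in> cen q})"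
      using zc by auto
  next
    fix z assume z: "z \<in> topspace T - (\<Union>s\<in>S - cen q. {z \<in> topspace T. inv s \<otimes> z \<in> cen q})"
    then have zc: "z \<in> carrier G" by simp
    obtain s where s: "s \<in> S" "inv s \<otimes> z \<in> cen q"
      using separated_transversal[OF q(1) S zc] by blast
    with z have "s \<in> cen q" by auto
    then have "s \<otimes> (inv s \<otimes> z) \<in> cen q"
      by (rule subgroup.m_closed[OF C _ s(2)])
    then show "z \<in> cen q"
      using s S zc by (auto simp: mult_inv_cancel)
  qed
  also have "openin T \<dots>"
    using S cls by (intro openin_diff openin_topspace closedin_Union) auto
  finally show ?thesis .
qed

text \<open>Not commuting with the commutator is an open condition on the pair of \<open>q\<close>
  and \<open>z\<close>, and the complement of \<open>cen p\<close> is compact. By the tube lemma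
  this complement also avoids \<open>cen q\<close> for all \<open>q\<close> near
  \<open>p\<close>.\<close>

lemma cen_locally_subset:
  assumes p: "p \<in> carrier G \<times> carrier G" and op: "openin T (cen p)"
  obtains R where "openin T2 R" "p \<in> R" "\<And>q. q \<in> R \<Longrightarrow> cen q \<subseteq> cen p"
proof -
  let ?W = "topspace (prod_topology T2 T) -
    {w \<in> topspace (prod_topology T2 T). gcomm G (gcomm G (fst (fst w)) (snd (fst w))) (snd w) = \<one>}"
  have W: "openin (prod_topology T2 T) ?W"
    by (intro openin_diff openin_topspace closedin_eq_one continuous_intros)
      (rule continuous_map_ident)+
  have "compactin T (topspace T - cen p)"
    by (intro closedin_compact_space compact_T closedin_diff closedin_topspace op)
  moreover have "{p} \<times> (topspace T - cen p) \<subseteq> ?W"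
    using p by (auto simp: cen_iff gcomm3_def)
  ultimately obtain R V where R: "openin T2 R" "p \<in> R" "topspace T - cen p \<subseteq> V" "R \<times> V \<subseteq> ?W"
    using tube_lemma_right[OF W, of "topspace T - cen p" p] p by auto
  show ?thesis
  proof (rule that[OF R(1,2)])
    fix q assume q: "q \<in> R"
    then have qc: "q \<in> carrier G \<times> carrier G"
      using openin_subset[OF R(1)] by auto
    show "cen q \<subseteq> cen p"
    proof (rule ccontr)
      assume "\<not> cen q \<subseteq> cen p"
      then obtain z where z: "z \<in> cen q" "z \<notin> cen p" by blast
      then have "z \<in> topspace T - cen p"
        using qc by (simp add: cen_iff)
      then have "(q, z) \<in> ?W"
        using R(3,4) q by blast
      then show False
        using z qc by (simp add: cen_iff gcomm3_def)
    qed
  qed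
qed

text \<open>The index of \<open>cen p\<close> is at least \<open>n\<close> and that of
  \<open>cen q\<close> at most \<open>n\<close>, so the inclusion cannot be proper.\<close>

lemma cen_eq_of_subset:
  assumes p: "p \<in> carrier G \<times> carrier G" "p \<notin> small_index n"
    and q: "q \<in> small_index (Suc n)"
    and sub: "cen q \<subseteq> cen p"
  shows "cen p \<subseteq> cen q"
proof
  have qc: "q \<in> carrier G \<times> carrier G"
    using q by (simp add: small_index_def)
  note Cp = cen_subgroup[OF p(1)] and Cq = cen_subgroup[OF qc]
  obtain S where S: "finite S" "card S = n" "S \<subseteq> carrier G" and sepp: "separated S p"
    using p by (auto simp: small_index_def)
  have sepq: "separated S q"
    using sepp sub by (auto simp: separated_def)
  fix z assume z: "z \<in> cen p"
  then have zc: "z \<in> carrier G"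
    using subgroup.subset[OF Cp] by auto
  obtain s where s: "s \<in> S" "inv s \<otimes> z \<in> cen q"
    using separated_transversal[OF q S sepq zc] by blast
  \<comment> \<open>Here \<open>t\<close> represents the coset \<open>cen q\<close> itself. Since
    \<open>s\<close> and \<open>t\<close> both lie in \<open>cen p\<close>, separation for
    \<open>p\<close> makes them equal, which puts \<open>z\<close> in \<open>cen q\<close>.\<close>
  obtain t where t: "t \<in> S" "inv t \<otimes> \<one> \<in> cen q"
    using separated_transversal[OF q S sepq, of \<one>] by blast
  have [simp]: "s \<in> carrier G" "t \<in> carrier G"
    using s t S by auto
  have "inv t \<in> cen q"
    using t by simp
  moreover have "z \<otimes> inv (inv s \<otimes> z) \<in> cen p"
    using s sub by (intro subgroup.m_closed[OF Cp z] subgroup.m_inv_closed[OF Cp]) auto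
  then have "s \<in> cen p"
    using zc by (simp add: inv_mult_group mult_inv_cancel)
  ultimately have "inv t \<otimes> s \<in> cen p"
    using sub Cp by (auto intro: subgroup.m_closed)
  then have "t = s"
    using sepp s t by (auto simp: separated_def)
  then have "inv (inv t) \<otimes> (inv s \<otimes> z) \<in> cen q"
    by (intro subgroup.m_closed[OF Cq _ s(2)] subgroup.m_inv_closed[OF Cq] \<open>inv t \<in> cen q\<close>)
  then show "z \<in> cen q"
    using zc \<open>t = s\<close> by (simp add: mult_inv_cancel)
qed

end

section \<open>Haar measure\<close>

locale haar_triple = compact_hausdorff_group G T
  for G :: "('a, 'b) monoid_scheme" (structure) and T +
  fixes M :: "('a \<times> 'a \<times> 'a) measure"
  assumes haar3: "haar3 G T M"
begin

lemma space_M: "space M = carrier G \<times> carrier G \<times> carrier G"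
  and sets_M: "sets M = sigma_sets (space M) {U. openin (top3 T) U}"
  and emeasure_space_M: "emeasure M (space M) = 1"
  and translate: "g \<in> space M \<Longrightarrow> A \<in> sets M \<Longrightarrow> emeasure M (mult3 G g ` A) = emeasure M A"
  and outer_regular: "A \<in> sets M \<Longrightarrow>
    emeasure M A = (INF U \<in> {U. openin (top3 T) U \<and> A \<subseteq> U}. emeasure M U)"
  using haar3 unfolding haar3_def by blast+

lemma finite_M: "finite_measure M"
  by (rule finite_measureI) (simp add: emeasure_space_M)

sublocale finite_measure M
  by (rule finite_M)

lemma open_sets: "openin (top3 T) U \<Longrightarrow> U \<in> sets M"
  by (auto simp: sets_M intro: sigma_sets.Basic)

lemma closed_sets: assumes "closedin (top3 T) A" shows "A \<in> sets M"
proof -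
  have "space M - (topspace (top3 T) - A) \<in> sets M"
    by (intro sets.compl_sets open_sets openin_diff openin_topspace assms)
  also have "space M - (topspace (top3 T) - A) = A"
    using closedin_subset[OF assms] by (auto simp: space_M)
  finally show ?thesis .
qed

lemma measure_le_1: "measure M A \<le> 1"
  using bounded_measure[of A] emeasure_space_M by (simp add: measure_def)

lemma measure_translate:
  "g \<in> space M \<Longrightarrow> A \<in> sets M \<Longrightarrow> measure M (mult3 G g ` A) = measure M A"
  by (simp add: measure_def translate)

lemma closedin_translate:
  assumes g: "g \<in> space M" and A: "closedin (top3 T) A"
  shows "closedin (top3 T) (mult3 G g ` A)"
proof -
  have "continuous_map (top3 T) (top3 T) (mult3 G g)"
    using g unfolding top3_def mult3_def
    by (intro continuous_intros) (auto simp: space_M intro: continuous_map_ident)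
  then show ?thesis
    by (intro compactin_imp_closedin[OF Hausdorff_top3]
        image_compactin[OF closedin_compact_space[OF compact_top3 A]])
qed

lemma outer_approx:
  assumes A: "A \<in> sets M" and e: "e > 0"
  obtains U where "openin (top3 T) U" "A \<subseteq> U" "measure M U < measure M A + e"
proof -
  have "emeasure M A < ennreal (measure M A + e)"
    using e by (simp add: emeasure_eq_measure ennreal_less_iff)
  then have "(INF U \<in> {U. openin (top3 T) U \<and> A \<subseteq> U}. emeasure M U) < ennreal (measure M A + e)"
    by (simp add: outer_regular[OF A])
  then obtain U where "openin (top3 T) U" "A \<subseteq> U" "emeasure M U < ennreal (measure M A + e)"
    by (auto simp: INF_less_iff)
  then show ?thesis
    using that by (auto simp: emeasure_eq_measure ennreal_less_iff)
qed

text \<open>The product of \<open>P\<close> with the group, as a set of triples. Its measure stands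
  in for the Haar measure of \<open>P\<close>, so no measure on pairs has to be constructed.\<close>

definition cyl :: "('a \<times> 'a) set \<Rightarrow> ('a \<times> 'a \<times> 'a) set" where
  "cyl P = {(x, y, z). (x, y) \<in> P \<and> x \<in> carrier G \<and> y \<in> carrier G \<and> z \<in> carrier G}"

lemma cyl_simps:
  "cyl (P \<inter> Q) = cyl P \<inter> cyl Q" "cyl (P \<union> Q) = cyl P \<union> cyl Q"
  "cyl (P - Q) = cyl P - cyl Q" "cyl {} = {}"
  by (auto simp: cyl_def)

lemma continuous_map_base: "continuous_map (top3 T) T2 (\<lambda>p. (fst p, fst (snd p)))"
  unfolding top3_def by (intro continuous_intros) (rule continuous_map_ident)+

lemma cyl_eq: "cyl P = {p \<in> topspace (top3 T). (fst p, fst (snd p)) \<in> P}"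
  by (auto simp: cyl_def)

lemma openin_cyl: "openin T2 P \<Longrightarrow> openin (top3 T) (cyl P)"
  unfolding cyl_eq by (rule openin_continuous_map_preimage[OF continuous_map_base])

lemma closedin_cyl: "closedin T2 P \<Longrightarrow> closedin (top3 T) (cyl P)"
  unfolding cyl_eq by (rule closedin_continuous_map_preimage[OF continuous_map_base])

section \<open>Index bounds from the measure of \<open>N2 G\<close>\<close>

lemma N2_sets: "N2 G \<in> sets M"
  by (rule closed_sets[OF closedin_N2])

text \<open>Translating the third coordinate by \<open>s \<in> S\<close> preserves
  \<open>cyl P\<close> and the measure. The translates are disjoint:
  \<open>r \<otimes> z = s \<otimes> z'\<close> with \<open>z\<close>, \<open>z'\<close> in
  \<open>cen (x, y)\<close> would put \<open>inv r \<otimes> s\<close> there too.\<close>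

lemma measure_N2_separated:
  assumes S: "finite S" "S \<subseteq> carrier G" and P: "cyl P \<in> sets M"
    and sep: "\<And>q. q \<in> P \<Longrightarrow> separated S q"
  shows "card S * measure M (N2 G \<inter> cyl P) \<le> measure M (cyl P)"
proof -
  define t where "t s = mult3 G (\<one>, \<one>, s)" for s
  have sG: "(\<one>, \<one>, s) \<in> space M" if "s \<in> S" for s
    using that S by (auto simp: space_M)
  have img: "t s ` (N2 G \<inter> cyl P) = t s ` N2 G \<inter> cyl P" if "s \<in> S" for s
  proof -
    have "s \<in> carrier G" using that S by auto
    then have "t s p \<in> cyl P \<longleftrightarrow> p \<in> cyl P" if "p \<in> N2 G" for p
      using that by (auto simp: t_def mult3_def cyl_def N2_def)
    then show ?thesis by blast
  qed
  have meas: "t s ` (N2 G \<inter> cyl P) \<in> sets M" if "s \<in> S" for s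
    unfolding img[OF that] unfolding t_def
    by (intro sets.Int P closed_sets[OF closedin_translate] sG that closedin_N2)
  have disj: "disjoint_family_on (\<lambda>s. t s ` (N2 G \<inter> cyl P)) S"
    unfolding disjoint_family_on_def
  proof (intro ballI impI, rule ccontr)
    fix r s assume rs: "r \<in> S" "s \<in> S" "r \<noteq> s"
      and "t r ` (N2 G \<inter> cyl P) \<inter> t s ` (N2 G \<inter> cyl P) \<noteq> {}"
    then obtain p p' where "p \<in> N2 G \<inter> cyl P" "p' \<in> N2 G \<inter> cyl P" "t r p = t s p'"
      by blast
    then obtain x y z x' y' z' where
      p: "(x, y, z) \<in> N2 G \<inter> cyl P" "(x', y', z') \<in> N2 G \<inter> cyl P"
      and e: "t r (x, y, z) = t s (x', y', z')"
      by (metis prod_cases3)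
    have c [simp]: "x \<in> carrier G" "y \<in> carrier G" "z \<in> carrier G" "x' \<in> carrier G"
        "y' \<in> carrier G" "z' \<in> carrier G" "r \<in> carrier G" "s \<in> carrier G"
      using p rs S by (auto simp: cyl_def)
    have eq: "x' = x" "y' = y" "r \<otimes> z = s \<otimes> z'"
      using e by (auto simp: t_def mult3_def)
    have z: "z \<in> cen (x, y)" "z' \<in> cen (x, y)" and q: "(x, y) \<in> P"
      using p eq by (auto simp: N2_iff cyl_def)
    have C: "subgroup (cen (x, y)) G"
      by (rule cen_subgroup) auto
    have "z \<otimes> inv z' \<in> cen (x, y)"
      using C z by (intro subgroup.m_closed subgroup.m_inv_closed)
    also have "z \<otimes> inv z' = inv r \<otimes> (r \<otimes> z) \<otimes> inv z'"
      by (simp add: mult_inv_cancel)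
    also have "\<dots> = inv r \<otimes> s"
      unfolding eq(3) by (simp add: m_assoc)
    finally show False
      using sep[OF q] rs by (auto simp: separated_def)
  qed
  have "card S * measure M (N2 G \<inter> cyl P) = (\<Sum>s\<in>S. measure M (t s ` (N2 G \<inter> cyl P)))"
    unfolding t_def using P sG N2_sets by (simp add: measure_translate)
  also have "\<dots> = measure M (\<Union>s\<in>S. t s ` (N2 G \<inter> cyl P))"
    using meas disj by (intro finite_measure_finite_Union[symmetric] S) auto
  also have "\<dots> \<le> measure M (cyl P)"
    using img P by (intro finite_measure_mono) auto
  finally show ?thesis .
qed

text \<open>The separating set may now vary over \<open>P\<close>. The induction splits off the part
  of \<open>P\<close> separated by one \<open>S\<close> and treats the rest by the remaining sets,
  so \<open>P\<close> must be arbitrary.\<close>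

lemma measure_N2_finite_cover:
  assumes "finite \<S>" and P: "cyl P \<in> sets M"
    and S: "\<And>S. S \<in> \<S> \<Longrightarrow> finite S \<and> card S = n \<and> S \<subseteq> carrier G"
    and cover: "\<And>q. q \<in> P \<Longrightarrow> \<exists>S\<in>\<S>. separated S q"
    and PG: "P \<subseteq> carrier G \<times> carrier G"
  shows "n * measure M (N2 G \<inter> cyl P) \<le> measure M (cyl P)"
  using assms
proof (induction \<S> arbitrary: P rule: finite_induct)
  case empty
  then have "P = {}" by auto
  then show ?case by (simp add: cyl_simps)
next
  case (insert S \<S>)
  define Q where "Q = {q \<in> carrier G \<times> carrier G. separated S q}"
  have S: "finite S" "card S = n" "S \<subseteq> carrier G"
    using insert.prems by auto
  have Q: "cyl Q \<in> sets M"
    unfolding Q_def by (intro open_sets openin_cyl openin_separated S)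
  have sets: "cyl (P \<inter> Q) \<in> sets M" "cyl (P - Q) \<in> sets M"
    using Q insert.prems(1) by (auto simp: cyl_simps)
  have "card S * measure M (N2 G \<inter> cyl (P \<inter> Q)) \<le> measure M (cyl (P \<inter> Q))"
    by (intro measure_N2_separated S sets) (auto simp: Q_def)
  moreover have "n * measure M (N2 G \<inter> cyl (P - Q)) \<le> measure M (cyl (P - Q))"
  proof (rule insert.IH)
    show "cyl (P - Q) \<in> sets M" by (rule sets)
    show "\<exists>S\<in>\<S>. separated S q" if "q \<in> P - Q" for q
      using insert.prems(3)[of q] insert.prems(4) that by (auto simp: Q_def)
  qed (use insert.prems in auto)
  moreover have "measure M (cyl P) = measure M (cyl (P \<inter> Q)) + measure M (cyl (P - Q))"
  proof -
    have "cyl P = cyl (P \<inter> Q) \<union> cyl (P - Q)"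
      by (auto simp: cyl_simps)
    then show ?thesis
      using finite_measure_Union[OF sets] by (auto simp: cyl_simps)
  qed
  moreover have "measure M (N2 G \<inter> cyl P) =
      measure M (N2 G \<inter> cyl (P \<inter> Q)) + measure M (N2 G \<inter> cyl (P - Q))"
  proof -
    have "N2 G \<inter> cyl P = (N2 G \<inter> cyl (P \<inter> Q)) \<union> (N2 G \<inter> cyl (P - Q))"
      by (auto simp: cyl_simps)
    moreover have "(N2 G \<inter> cyl (P \<inter> Q)) \<inter> (N2 G \<inter> cyl (P - Q)) = {}"
      by (auto simp: cyl_simps)
    ultimately show ?thesis
      using finite_measure_Union[of "N2 G \<inter> cyl (P \<inter> Q)" "N2 G \<inter> cyl (P - Q)"] sets N2_sets
      by auto
  qed
  ultimately show ?case
    using S by (simp add: distrib_left)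
qed

text \<open>Outer regularity encloses \<open>cyl E\<close> in a small open \<open>U\<close>. The
  projection \<open>K\<close> of the compact set \<open>B - U\<close> misses \<open>E\<close>
  because \<open>cyl E\<close> is a union of full fibres.\<close>

lemma compact_avoiding_null:
  assumes E: "closedin T2 E" "measure M (cyl E) = 0" and B: "closedin (top3 T) B" and e: "e > 0"
  obtains K where "compactin T2 K" "K \<inter> E = {}" "measure M B < measure M (B \<inter> cyl K) + e"
proof -
  obtain U where U: "openin (top3 T) U" "cyl E \<subseteq> U" "measure M U < e"
    using outer_approx[OF closed_sets[OF closedin_cyl[OF E(1)]] e] E(2) by auto
  define K where "K = (\<lambda>p. (fst p, fst (snd p))) ` (B - U)"
  have BU: "closedin (top3 T) (B - U)"
    using B U by (intro closedin_diff)
  have K: "compactin T2 K"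
    unfolding K_def
    by (intro image_compactin[OF closedin_compact_space[OF compact_top3 BU] continuous_map_base])
  have Bsub: "B \<subseteq> topspace (top3 T)"
    by (rule closedin_subset[OF B])
  have "K \<inter> E = {}"
    using U(2) Bsub unfolding K_def cyl_eq by auto
  have cK: "cyl K \<in> sets M"
    by (intro closed_sets closedin_cyl compactin_imp_closedin[OF Hausdorff_T2 K])
  have "B \<subseteq> (B \<inter> cyl K) \<union> U"
    using Bsub unfolding K_def cyl_eq by auto
  then have "measure M B \<le> measure M ((B \<inter> cyl K) \<union> U)"
    using cK closed_sets[OF B] open_sets[OF U(1)] by (intro finite_measure_mono) auto
  also have "\<dots> \<le> measure M (B \<inter> cyl K) + measure M U"
    using cK closed_sets[OF B] open_sets[OF U(1)] by (intro measure_Un_le) auto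
  finally show ?thesis
    using U(3) that[OF K \<open>K \<inter> E = {}\<close>] by linarith
qed

lemma small_index_positive:
  assumes "measure M (N2 G) > 0"
  shows "\<exists>n. measure M (cyl (small_index n)) > 0"
proof (rule ccontr)
  assume "\<not> ?thesis"
  then have null: "measure M (cyl (small_index n)) = 0" for n
    using measure_nonneg[of M "cyl (small_index n)"] by (metis less_eq_real_def)
  define m where "m = measure M (N2 G)"
  \<comment> \<open>Passing to the compact \<open>K\<close> may cost up to half of \<open>m\<close>,
    so the bound is aimed at \<open>m / 2\<close>.\<close>
  obtain n :: nat where n: "n * (m / 2) > 1"
    using assms reals_Archimedean3[of "m / 2", rule_format, of 1] by (auto simp: m_def)
  obtain K where K: "compactin T2 K" "K \<inter> small_index n = {}"
    and mK: "m < measure M (N2 G \<inter> cyl K) + m / 2"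
    using compact_avoiding_null[OF closedin_small_index null closedin_N2, of "m / 2"] assms
    unfolding m_def by auto
  let ?I = "{S. finite S \<and> card S = n \<and> S \<subseteq> carrier G}"
  let ?O = "\<lambda>S. {q \<in> carrier G \<times> carrier G. separated S q}"
  have KG: "K \<subseteq> carrier G \<times> carrier G"
    using compactin_subset_topspace[OF K(1)] by simp
  have "K \<subseteq> \<Union>(?O ` ?I)"
  proof
    fix q assume q: "q \<in> K"
    then have "q \<in> carrier G \<times> carrier G" "q \<notin> small_index n"
      using K(2) KG by auto
    then obtain S where "S \<in> ?I" "q \<in> ?O S"
      unfolding small_index_def by blast
    then show "q \<in> \<Union>(?O ` ?I)" by (rule UN_I)
  qed
  moreover have "openin T2 U" if "U \<in> ?O ` ?I" for U
    using that by (auto intro: openin_separated)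
  ultimately have "\<exists>\<F>. finite \<F> \<and> \<F> \<subseteq> ?O ` ?I \<and> K \<subseteq> \<Union>\<F>"
    by (intro K(1)[unfolded compactin_def, THEN conjunct2, rule_format] conjI ballI)
  then obtain \<F> where \<F>: "finite \<F>" "\<F> \<subseteq> ?O ` ?I" "K \<subseteq> \<Union>\<F>"
    by (elim exE conjE)
  obtain \<S> where \<S>: "\<S> \<subseteq> ?I" "finite \<S>" "\<F> = ?O ` \<S>"
    using finite_subset_image[OF \<F>(1,2)] by (elim exE conjE)
  have "n * measure M (N2 G \<inter> cyl K) \<le> measure M (cyl K)"
  proof (rule measure_N2_finite_cover[OF \<S>(2) _ _ _ KG])
    show "cyl K \<in> sets M"
      by (intro closed_sets closedin_cyl compactin_imp_closedin[OF Hausdorff_T2 K(1)])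
    show "\<exists>S\<in>\<S>. separated S q" if "q \<in> K" for q
      using that \<F>(3) \<S>(3) by auto
  qed (use \<S>(1) in auto)
  moreover have "n * (m / 2) \<le> n * measure M (N2 G \<inter> cyl K)"
    using mK by (intro mult_left_mono) auto
  ultimately show False
    using n measure_le_1[of "cyl K"] by linarith
qed

lemma open_centralizer_positive:
  assumes "measure M (N2 G) > 0"
  obtains C where "subgroup C G" "openin T C"
    "measure M (cyl {q \<in> carrier G \<times> carrier G. C \<subseteq> cen q}) > 0"
proof -
  define k where "k = (LEAST n. measure M (cyl (small_index n)) > 0)"
  have pos: "measure M (cyl (small_index k)) > 0"
    unfolding k_def using small_index_positive[OF assms] by (rule LeastI_ex)
  \<comment> \<open>No index is less than \<open>0\<close>, so \<open>small_index 0\<close> is empty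
    and \<open>k\<close> has a predecessor, whose cylinder is null by minimality.\<close>
  then have "k \<noteq> 0"
    by (auto simp: cyl_simps intro: ccontr)
  then obtain n where kn: "k = Suc n"
    using not0_implies_Suc by blast
  have "\<not> measure M (cyl (small_index n)) > 0"
    using not_less_Least[of n "\<lambda>n. measure M (cyl (small_index n)) > 0"] kn
    unfolding k_def[symmetric] by auto
  then have null: "measure M (cyl (small_index n)) = 0"
    using measure_nonneg[of M "cyl (small_index n)"] by linarith
  \<comment> \<open>The allowed error is the whole measure of \<open>cyl (small_index k)\<close>,
    which is just enough to leave positive measure over \<open>K0\<close>.\<close>
  obtain K0 where K0: "compactin T2 K0" "K0 \<inter> small_index n = {}"
    and mK0: "measure M (cyl (small_index k)) <
      measure M (cyl (small_index k) \<inter> cyl K0) + measure M (cyl (small_index k))"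
    using compact_avoiding_null[OF closedin_small_index null closedin_cyl[OF closedin_small_index] pos]
    by blast
  \<comment> \<open>On \<open>K\<close> the index is exactly \<open>n\<close>.\<close>
  define K where "K = K0 \<inter> small_index k"
  have K: "compactin T2 K"
    unfolding K_def by (intro compact_Int_closedin K0 closedin_small_index)
  have Kn: "q \<in> small_index (Suc n)" "q \<notin> small_index n" "q \<in> carrier G \<times> carrier G" if "q \<in> K" for q
    using that K0(2) kn by (auto simp: K_def small_index_def)
  have mK: "measure M (cyl K) > 0"
    using mK0 by (simp add: K_def cyl_simps Int_commute)
  have "\<exists>R. openin T2 R \<and> p \<in> R \<and> (\<forall>q\<in>R. cen q \<subseteq> cen p)" if "p \<in> K" for p
    by (rule cen_locally_subset[OF Kn(3)[OF that] openin_cen[OF Kn(1,2)[OF that]]]) blast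
  then obtain R where R: "\<And>p. p \<in> K \<Longrightarrow> openin T2 (R p)" "\<And>p. p \<in> K \<Longrightarrow> p \<in> R p"
    "\<And>p q. p \<in> K \<Longrightarrow> q \<in> R p \<Longrightarrow> cen q \<subseteq> cen p"
    by metis
  have "K \<subseteq> \<Union>(R ` K)"
    using R(2) by auto
  then obtain \<F> where \<F>: "finite \<F>" "\<F> \<subseteq> R ` K" "K \<subseteq> \<Union>\<F>"
    using K[unfolded compactin_def, THEN conjunct2, THEN spec, of "R ` K"] R(1) by auto
  obtain L where L: "L \<subseteq> K" "finite L" "\<F> = R ` L"
    using finite_subset_image[OF \<F>(1,2)] by (elim exE conjE)
  \<comment> \<open>For \<open>q\<close> in \<open>K\<close> and in \<open>R p\<close>, equality of
    the indices reverses the inclusion \<open>cen q \<subseteq> cen p\<close>. So the finitely many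
    sets \<open>F p\<close> cover \<open>K\<close>, and one of their cylinders has positive
    measure.\<close>
  define F where "F p = {q \<in> carrier G \<times> carrier G. cen p \<subseteq> cen q}" for p
  have Fs: "cyl (F p) \<in> sets M" if "p \<in> L" for p
  proof -
    have "subgroup (cen p) G"
      using that L(1) by (intro cen_subgroup Kn(3)) auto
    then have "cen p \<subseteq> carrier G" "cen p \<noteq> {}"
      using subgroup.subset subgroup.one_closed by blast+
    then show ?thesis
      unfolding F_def by (intro closed_sets closedin_cyl closedin_subset_cen)
  qed
  have "K \<subseteq> (\<Union>p\<in>L. F p)"
  proof
    fix q assume q: "q \<in> K"
    then obtain p where p: "p \<in> L" "q \<in> R p"
      using \<F>(3) L(3) by auto
    then have "p \<in> K" using L by auto
    have "cen p \<subseteq> cen q"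
      by (rule cen_eq_of_subset[OF Kn(3,2)[OF \<open>p \<in> K\<close>] Kn(1)[OF q] R(3)[OF \<open>p \<in> K\<close> p(2)]])
    then show "q \<in> (\<Union>p\<in>L. F p)"
      using p Kn(3)[OF q] by (auto simp: F_def)
  qed
  then have "cyl K \<subseteq> (\<Union>p\<in>L. cyl (F p))"
    by (fastforce simp: cyl_def)
  then have "measure M (cyl K) \<le> measure M (\<Union>p\<in>L. cyl (F p))"
    using Fs L(2) by (intro finite_measure_mono) auto
  also have "\<dots> \<le> (\<Sum>p\<in>L. measure M (cyl (F p)))"
    using Fs L(2) by (intro finite_measure_subadditive_finite) auto
  finally have "(\<Sum>p\<in>L. measure M (cyl (F p))) > 0"
    using mK by linarith
  then obtain p where p: "p \<in> L" "measure M (cyl (F p)) > 0"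
    using sum_nonpos[of L "\<lambda>p. measure M (cyl (F p))"] by (meson not_less)
  then have "p \<in> K" using L by auto
  show ?thesis
    using that[OF cen_subgroup[OF Kn(3)] openin_cen[OF Kn(1,2)]] \<open>p \<in> K\<close> p(2)
    unfolding F_def by blast
qed

text \<open>Translates of \<open>B\<close> by elements near the identity stay in an open
  \<open>V\<close> barely larger than \<open>B\<close>. Each of the four misses less than a quarter
  of the measure of \<open>B\<close> inside \<open>V\<close>, so they have a common point.\<close>

lemma four_translates_meet:
  assumes F: "closedin T2 F" and pos: "measure M (cyl F) > 0"
  obtains U where "openin T U" "\<one> \<in> U"
    "\<And>a b. a \<in> U \<Longrightarrow> b \<in> U \<Longrightarrow> \<exists>x\<in>carrier G. \<exists>y\<in>carrier G.
       (x, y) \<in> F \<and> (a \<otimes> x, y) \<in> F \<and> (x, b \<otimes> y) \<in> F \<and> (a \<otimes> x, b \<otimes> y) \<in> F"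
proof -
  define B where "B = cyl F"
  have B: "closedin (top3 T) B" and BM: "B \<in> sets M"
    unfolding B_def by (auto intro: closedin_cyl closed_sets F)
  have Bsub: "B \<subseteq> topspace (top3 T)"
    by (rule closedin_subset[OF B])
  obtain V where V: "openin (top3 T) V" "B \<subseteq> V" "measure M V < measure M B + measure M B / 4"
    using outer_approx[OF BM, of "measure M B / 4"] pos by (auto simp: B_def)
  \<comment> \<open>The translating pair and the point vary jointly, so that the tube lemma gives
    one neighbourhood \<open>N\<close> serving all points of \<open>B\<close>.\<close>
  let ?f = "\<lambda>w. mult3 G (fst (fst w), snd (fst w), \<one>) (snd w)"
  let ?W = "{w \<in> topspace (prod_topology T2 (top3 T)). ?f w \<in> V}"
  have "continuous_map (prod_topology T2 (top3 T)) (top3 T) ?f"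
    unfolding top3_def mult3_def fst_conv snd_conv
    by (intro continuous_intros) (rule continuous_map_ident | simp)+
  then have W: "openin (prod_topology T2 (top3 T)) ?W"
    by (rule openin_continuous_map_preimage[OF _ V(1)])
  have "?f ((\<one>, \<one>), p) = p" if "p \<in> B" for p
    using that Bsub by (auto simp: mult3_def)
  then have "{(\<one>, \<one>)} \<times> B \<subseteq> ?W"
    using V(2) Bsub by auto
  with tube_lemma_right[OF W closedin_compact_space[OF compact_top3 B], of "(\<one>, \<one>)"]
  obtain N V' where N: "openin T2 N" "(\<one>, \<one>) \<in> N" "B \<subseteq> V'" and NW: "N \<times> V' \<subseteq> ?W"
    by (metis (no_types, lifting) SigmaI one_closed topspace_T topspace_prod_topology)
  obtain U1 U2 where U: "openin T U1" "openin T U2" "\<one> \<in> U1" "\<one> \<in> U2" "U1 \<times> U2 \<subseteq> N"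
    using N(1,2) unfolding openin_prod_topology_alt by meson
  show ?thesis
  proof (rule that[of "U1 \<inter> U2"])
    show "openin T (U1 \<inter> U2)" "\<one> \<in> U1 \<inter> U2"
      using U by auto
    fix a b assume ab: "a \<in> U1 \<inter> U2" "b \<in> U1 \<inter> U2"
    have abG: "a \<in> carrier G" "b \<in> carrier G"
      using ab openin_subset[OF U(1)] by auto
    define I where "I = {(\<one>, \<one>), (a, \<one>), (\<one>, b), (a, b)}"
    define t where "t i = mult3 G (fst i, snd i, \<one>) ` B" for i
    have IN: "i \<in> N" if "i \<in> I" for i
      using that ab U by (auto simp: I_def)
    have Isp: "(fst i, snd i, \<one>) \<in> space M" if "i \<in> I" for i
      using that abG by (auto simp: I_def space_M)
    have tM: "t i \<in> sets M" if "i \<in> I" for i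
      unfolding t_def by (intro closed_sets closedin_translate Isp that B)
    have tV: "t i \<subseteq> V" if "i \<in> I" for i
    proof -
      have "(i, p) \<in> ?W" if "p \<in> B" for p
        using subsetD[OF NW, of "(i, p)"] IN[OF \<open>i \<in> I\<close>] N(3) that by blast
      then show ?thesis
        by (auto simp: t_def)
    qed
    have tm: "measure M (t i) = measure M B" if "i \<in> I" for i
      unfolding t_def by (intro measure_translate Isp that BM)
    have "(\<Inter>i\<in>I. t i) \<noteq> {}"
    proof
      assume "(\<Inter>i\<in>I. t i) = {}"
      then have "V \<subseteq> (\<Union>i\<in>I. V - t i)" by auto
      then have "measure M V \<le> measure M (\<Union>i\<in>I. V - t i)"
        using tM open_sets[OF V(1)] by (intro finite_measure_mono) (auto simp: I_def)
      also have "\<dots> \<le> (\<Sum>i\<in>I. measure M (V - t i))"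
        using tM open_sets[OF V(1)] by (intro finite_measure_subadditive_finite) (auto simp: I_def)
      also have "\<dots> = (\<Sum>i\<in>I. measure M V - measure M B)"
        using tM tV tm open_sets[OF V(1)] by (intro sum.cong refl) (simp add: finite_measure_Diff)
      also have "\<dots> = card I * (measure M V - measure M B)"
        by simp
      \<comment> \<open>Only an inequality, since members of \<open>I\<close> coincide when
        \<open>a\<close> or \<open>b\<close> is \<open>\<one>\<close>.\<close>
      also have "\<dots> \<le> 4 * (measure M V - measure M B)"
      proof (rule mult_right_mono)
        show "real (card I) \<le> 4"
          unfolding I_def by (simp add: card_insert_if)
        show "0 \<le> measure M V - measure M B"
          using finite_measure_mono[OF V(2) open_sets[OF V(1)]] by simp
      qed
      also have "\<dots> < measure M B"
        using V(3) by simp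
      also have "\<dots> \<le> measure M V"
        by (rule finite_measure_mono[OF V(2) open_sets[OF V(1)]])
      finally show False by simp
    qed
    then obtain x y z where xyz: "\<And>i. i \<in> I \<Longrightarrow> (x, y, z) \<in> t i"
      by auto
    have mem: "(inv u \<otimes> x, inv v \<otimes> y) \<in> F \<and> x \<in> carrier G \<and> y \<in> carrier G"
      if "(u, v) \<in> I" for u v
    proof -
      have [simp]: "u \<in> carrier G" "v \<in> carrier G"
        using that abG by (auto simp: I_def)
      show ?thesis
        using xyz[OF that] by (auto simp: t_def mult3_def B_def cyl_def mult_inv_cancel)
    qed
    have xy [simp]: "x \<in> carrier G" "y \<in> carrier G"
      using mem[of a b] by (auto simp: I_def)
    \<comment> \<open>Pulling the common point back by the four translations gives the four required
      points of \<open>F\<close>; the pullback by both \<open>a\<close> and \<open>b\<close> serves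
      as the base point.\<close>
    show "\<exists>x\<in>carrier G. \<exists>y\<in>carrier G.
       (x, y) \<in> F \<and> (a \<otimes> x, y) \<in> F \<and> (x, b \<otimes> y) \<in> F \<and> (a \<otimes> x, b \<otimes> y) \<in> F"
      using mem[of \<one> \<one>] mem[of a \<one>] mem[of \<one> b] mem[of a b] abG
      by (intro bexI[of _ "inv a \<otimes> x"] bexI[of _ "inv b \<otimes> y"]) (auto simp: I_def mult_inv_cancel)
  qed
qed

text \<open>Some conjugate of \<open>gcomm G a b\<close> centralizes \<open>C\<close>, while the
  same conjugate of \<open>c\<close> lies in \<open>C\<close>. Hence the two conjugates commute, and
  so do \<open>gcomm G a b\<close> and \<open>c\<close>.\<close>

lemma commutator_trivial_near_one:
  assumes "measure M (N2 G) > 0"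
  obtains W where "openin T W" "\<one> \<in> W"
    "\<And>a b c. a \<in> W \<Longrightarrow> b \<in> W \<Longrightarrow> c \<in> W \<Longrightarrow> gcomm3 G a b c = \<one>"
proof -
  obtain C where C: "subgroup C G" "openin T C"
    and pos: "measure M (cyl {q \<in> carrier G \<times> carrier G. C \<subseteq> cen q}) > 0"
    using open_centralizer_positive[OF assms] .
  have one: "\<one> \<in> C"
    by (rule subgroup.one_closed[OF C(1)])
  have CG: "C \<subseteq> carrier G"
    by (rule subgroup.subset[OF C(1)])
  have cl: "closedin T2 {q \<in> carrier G \<times> carrier G. C \<subseteq> cen q}"
    using one CG by (intro closedin_subset_cen) auto
  obtain U where U: "openin T U" "\<one> \<in> U"
    and meet: "\<And>a b. a \<in> U \<Longrightarrow> b \<in> U \<Longrightarrow> \<exists>x\<in>carrier G. \<exists>y\<in>carrier G.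
      C \<subseteq> cen (x, y) \<and> C \<subseteq> cen (a \<otimes> x, y) \<and> C \<subseteq> cen (x, b \<otimes> y) \<and> C \<subseteq> cen (a \<otimes> x, b \<otimes> y)"
    using four_translates_meet[OF cl pos, simplified mem_Collect_eq] by metis
  obtain V where V: "openin T V" "\<one> \<in> V"
    and conj: "\<And>g v. g \<in> carrier G \<Longrightarrow> v \<in> V \<Longrightarrow> inv g \<otimes> v \<otimes> g \<in> C"
    using small_conjugates[OF C(2) one] by blast
  have "gcomm3 G a b c = \<one>" if a: "a \<in> U" and b: "b \<in> U" and c: "c \<in> V" for a b c
  proof -
    have [simp]: "a \<in> carrier G" "b \<in> carrier G" "c \<in> carrier G"
      using a b c openin_subset[OF U(1)] openin_subset[OF V(1)] by auto
    obtain x y where [simp]: "x \<in> carrier G" "y \<in> carrier G"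
      and sub: "C \<subseteq> cen (x, y)" "C \<subseteq> cen (a \<otimes> x, y)" "C \<subseteq> cen (x, b \<otimes> y)" "C \<subseteq> cen (a \<otimes> x, b \<otimes> y)"
      using meet[OF a b] by blast
    define g where "g = y \<otimes> x"
    have [simp]: "g \<in> carrier G" by (simp add: g_def)
    define d where "d = gcomm G a b"
    have [simp]: "d \<in> carrier G" by (simp add: d_def)
    \<comment> \<open>Centralizing is symmetric: this is the membership that
      \<open>gcomm_mem_conjugate\<close> needs with the centralizer of \<open>C\<close> as
      \<open>D\<close>.\<close>
    have mem: "gcomm G u v \<in> centralizer C"
      if "C \<subseteq> cen (u, v)" "u \<in> carrier G" "v \<in> carrier G" for u v
      using centralizer_sym[of "{gcomm G u v}" C] that by (simp add: cen_def)
    have "inv g \<otimes> d \<otimes> g \<in> centralizer C"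
      unfolding g_def d_def
      by (intro gcomm_mem_conjugate centralizer_subgroup CG mem sub) simp_all
    then have comm: "(inv g \<otimes> c \<otimes> g) \<otimes> (inv g \<otimes> d \<otimes> g) = (inv g \<otimes> d \<otimes> g) \<otimes> (inv g \<otimes> c \<otimes> g)"
      using conj[of g c] c by (auto simp: centralizer_def)
    have "g \<otimes> ((inv g \<otimes> c \<otimes> g) \<otimes> (inv g \<otimes> d \<otimes> g)) \<otimes> inv g = c \<otimes> d"
      by (simp add: m_assoc mult_inv_cancel)
    moreover have "g \<otimes> ((inv g \<otimes> d \<otimes> g) \<otimes> (inv g \<otimes> c \<otimes> g)) \<otimes> inv g = d \<otimes> c"
      by (simp add: m_assoc mult_inv_cancel)
    ultimately have "d \<otimes> c = c \<otimes> d"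
      using comm by simp
    then show ?thesis
      by (simp add: gcomm3_def gcomm_eq_one_iff flip: d_def)
  qed
  then show ?thesis
    using U V by (intro that[of "U \<inter> V"]) auto
qed

end

theorem theorem3p2:
  fixes G :: "('a, 'b) monoid_scheme" and T :: "'a topology"
    and M :: "('a \<times> 'a \<times> 'a) measure"
  assumes "compact_group G T"
    and "haar3 G T M"
    and "emeasure M (N2 G) > 0"
  shows "\<exists>H. subgroup H G \<and> openin T H \<and> nilpotent2_on G H"
proof -
  have "group G"
    using assms(1) by (simp add: compact_group_def topological_group_def)
  then interpret haar_triple G T M
    using assms by (intro haar_triple.intro compact_hausdorff_group.intro
        compact_hausdorff_group_axioms.intro haar_triple_axioms.intro)
  have "measure M (N2 G) > 0"
    using assms(3) by (simp add: emeasure_eq_measure)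
  then obtain W where W: "openin T W" "\<one>\<^bsub>G\<^esub> \<in> W"
    "\<And>a b c. a \<in> W \<Longrightarrow> b \<in> W \<Longrightarrow> c \<in> W \<Longrightarrow> gcomm3 G a b c = \<one>\<^bsub>G\<^esub>"
    using commutator_trivial_near_one by blast
  have WG: "W \<subseteq> carrier G"
    using openin_subset[OF W(1)] by simp
  show ?thesis
    using generate_is_subgroup[OF WG] openin_generate[OF W(1,2)] generate_nilpotent2[OF WG W(3)]
    by blast
qed

end
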